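(* Let $G$ be a finite simple connected graph with $n$ vertices and $m$ edges. Then $$\begin{aligned}F(G^{---})={}&(3m+3n-11)F(G)-3(m+n-1)(m+n-5)M_1(G)+6(m+n-1)M_2(G)\\&-\xi_4(G)-3\,\mathrm{ReZG}_3(G)+(m+n)(m+n-1)^3-12m(m+n-1)^2.\end{aligned}$$
   Context: For a finite simple graph $H$ with vertex set $V(H)$ and edge set $E(H)$, $d_H(v)$ denotes the degree of the vertex $v$ in $H$. The F-index of $H$ is $F(H)=\sum_{v\in V(H)} d_H(v)^3$. The first and second Zagreb indices are $M_1(H)=\sum_{v\in V(H)} d_H(v)^2$ and $M_2(H)=\sum_{uv\in E(H)} d_H(u)d_H(v)$. Further, $\xi_4(H)=\sum_{v\in V(H)} d_H(v)^4=\sum_{uv\in E(H)}[d_H(u)^3+d_H(v)^3]$ and $\mathrm{ReZG}_3(H)=\sum_{uv\in E(H)} d_H(u)d_H(v)[d_H(u)+d_H(v)]$. For $x,y,z\in\{+,-\}$, the total transformation graph $G^{xyz}$ is the simple graph with vertex set $V(G)\cup E(G)$ (disjoint union) in which two distinct elements $u,v$ are adjacent if and only if one of the following holds: (i) $u,v\in V(G)$, and $u,v$ are adjacent in $G$ if $x=+$, respectively not adjacent in $G$ if $x=-$; (ii) $u,v\in E(G)$, and $u,v$ are adjacent in $G$ (share an endpoint) if $y=+$, respectively not adjacent in $G$ if $y=-$; (iii) one of them is a vertex of $G$ and the other is an edge of $G$, and they are incident in $G$ if $z=+$, respectively not incident in $G$ if $z=-$. *)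

theory Defs
  imports Complex_Main
begin

record 'a graph =
  verts :: "'a set"
  edges :: "'a set set"

text \<open>An edge is the two-element set of its endpoints.\<close>

definition finite_simple_graph :: "'a graph \<Rightarrow> bool" where
  "finite_simple_graph H \<longleftrightarrow>
     finite (verts H) \<and> (\<forall>e\<in>edges H. e \<subseteq> verts H \<and> card e = 2)"

definition adjacent :: "'a graph \<Rightarrow> 'a \<Rightarrow> 'a \<Rightarrow> bool" where
  "adjacent H u v \<longleftrightarrow> {u, v} \<in> edges H"

definition edge_adjacent :: "'a graph \<Rightarrow> 'a set \<Rightarrow> 'a set \<Rightarrow> bool" where
  "edge_adjacent H e f \<longleftrightarrow> e \<in> edges H \<and> f \<in> edges H \<and> e \<noteq> f \<and> e \<inter> f \<noteq> {}"

definition incident :: "'a graph \<Rightarrow> 'a \<Rightarrow> 'a set \<Rightarrow> bool" where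
  "incident H v e \<longleftrightarrow> e \<in> edges H \<and> v \<in> e"

text \<open>The graph without vertices does not count as connected.\<close>

definition connected_graph :: "'a graph \<Rightarrow> bool" where
  "connected_graph H \<longleftrightarrow>
     verts H \<noteq> {} \<and>
     (\<forall>u\<in>verts H. \<forall>v\<in>verts H. (u, v) \<in> {(a, b). adjacent H a b}\<^sup>*)"

definition degree :: "'a graph \<Rightarrow> 'a \<Rightarrow> nat" where
  "degree H v = card {e. incident H v e}"

definition F_index :: "'a graph \<Rightarrow> nat" where
  "F_index H = (\<Sum>v\<in>verts H. degree H v ^ 3)"

definition M1 :: "'a graph \<Rightarrow> nat" where
  "M1 H = (\<Sum>v\<in>verts H. degree H v ^ 2)"

text \<open>
  For an edge \<open>e = {u, v}\<close> with \<open>u \<noteq> v\<close>, sums and products over \<open>w \<in> e\<close> are the symmetric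
  expressions \<open>f u + f v\<close> and \<open>f u * f v\<close> in its two endpoints.
\<close>

definition M2 :: "'a graph \<Rightarrow> nat" where
  "M2 H = (\<Sum>e\<in>edges H. \<Prod>w\<in>e. degree H w)"

definition xi4 :: "'a graph \<Rightarrow> nat" where
  "xi4 H = (\<Sum>v\<in>verts H. degree H v ^ 4)"

definition ReZG3 :: "'a graph \<Rightarrow> nat" where
  "ReZG3 H = (\<Sum>e\<in>edges H. (\<Prod>w\<in>e. degree H w) * (\<Sum>w\<in>e. degree H w))"

datatype sign = Plus | Minus

fun signed :: "sign \<Rightarrow> bool \<Rightarrow> bool" where
  "signed Plus P \<longleftrightarrow> P"
| "signed Minus P \<longleftrightarrow> \<not> P"

text \<open>
  The adjacency condition of \<open>G\<^sup>x\<^sup>y\<^sup>z\<close>, to be used only for distinct elements of the disjoint union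
  of vertices (\<open>Inl\<close>) and edges (\<open>Inr\<close>); distinctness and membership are imposed in the
  definition of the graph itself.
\<close>

fun transformation_adj ::
  "sign \<Rightarrow> sign \<Rightarrow> sign \<Rightarrow> 'a graph \<Rightarrow> 'a + 'a set \<Rightarrow> 'a + 'a set \<Rightarrow> bool" where
  "transformation_adj x y z G (Inl u) (Inl v) \<longleftrightarrow> signed x (adjacent G u v)"
| "transformation_adj x y z G (Inr e) (Inr f) \<longleftrightarrow> signed y (edge_adjacent G e f)"
| "transformation_adj x y z G (Inl v) (Inr e) \<longleftrightarrow> signed z (incident G v e)"
| "transformation_adj x y z G (Inr e) (Inl v) \<longleftrightarrow> signed z (incident G v e)"

definition transformation_graph ::
  "sign \<Rightarrow> sign \<Rightarrow> sign \<Rightarrow> 'a graph \<Rightarrow> ('a + 'a set) graph" where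
  "transformation_graph x y z G =
     \<lparr> verts = verts G <+> edges G,
       edges = {{a, b} | a b. a \<in> verts G <+> edges G \<and> b \<in> verts G <+> edges G \<and>
                              a \<noteq> b \<and> transformation_adj x y z G a b} \<rparr>"

lemma finite_edges:
  assumes "finite_simple_graph H"
  shows "finite (edges H)"
proof (rule finite_subset)
  show "edges H \<subseteq> Pow (verts H)" using assms by (auto simp: finite_simple_graph_def)
  show "finite (Pow (verts H))" using assms by (simp add: finite_simple_graph_def)
qed

lemma finite_simple_graph_transformation_graph:
  assumes "finite_simple_graph G"
  shows "finite_simple_graph (transformation_graph x y z G)"
  using assms finite_edges[OF assms]
  by (auto simp: finite_simple_graph_def transformation_graph_def card_2_iff)

lemma transformation_adj_sym:
  "transformation_adj x y z G a b \<longleftrightarrow> transformation_adj x y z G b a"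
proof -
  have "adjacent G u v = adjacent G v u" for u v
    by (simp add: adjacent_def insert_commute)
  moreover have "edge_adjacent G e f = edge_adjacent G f e" for e f
    by (auto simp: edge_adjacent_def)
  ultimately show ?thesis by (cases a; cases b) auto
qed

lemma adjacent_transformation_graph:
  "adjacent (transformation_graph x y z G) a b \<longleftrightarrow>
     a \<in> verts G <+> edges G \<and> b \<in> verts G <+> edges G \<and> a \<noteq> b \<and>
     transformation_adj x y z G a b"
  by (auto simp: adjacent_def transformation_graph_def doubleton_eq_iff transformation_adj_sym)

lemma edge_endpoints:
  assumes "finite_simple_graph H" "{u, v} \<in> edges H"
  shows "(\<Prod>w\<in>{u, v}. degree H w) = degree H u * degree H v"
    and "(\<Sum>w\<in>{u, v}. degree H w) = degree H u + degree H v"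
proof -
  have "card {u, v} = 2" using assms by (auto simp: finite_simple_graph_def)
  then have "u \<noteq> v" by auto
  then show "(\<Prod>w\<in>{u, v}. degree H w) = degree H u * degree H v"
    and "(\<Sum>w\<in>{u, v}. degree H w) = degree H u + degree H v" by simp_all
qed

text \<open>The equivalent edge form of \<open>xi4\<close>.\<close>

lemma xi4_edges:
  assumes "finite_simple_graph H"
  shows "xi4 H = (\<Sum>e\<in>edges H. \<Sum>w\<in>e. degree H w ^ 3)"
proof -
  have fin: "finite (verts H)" "finite (edges H)"
    using assms finite_edges by (auto simp: finite_simple_graph_def)
  have "(\<Sum>e\<in>edges H. \<Sum>w\<in>e. degree H w ^ 3) =
        (\<Sum>e\<in>edges H. \<Sum>w\<in>{w \<in> verts H. w \<in> e}. degree H w ^ 3)"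
    using assms by (intro sum.cong) (auto simp: finite_simple_graph_def)
  also have "\<dots> = (\<Sum>w\<in>verts H. \<Sum>e\<in>{e \<in> edges H. w \<in> e}. degree H w ^ 3)"
    using fin by (rule sum.swap_restrict[OF _ _, symmetric])
  also have "\<dots> = xi4 H"
    by (simp add: xi4_def degree_def incident_def eval_nat_numeral)
  finally show ?thesis ..
qed

end

theory Submission
  imports Defs
begin

text \<open>
  With \<open>N = m + n - 1\<close>, a vertex \<open>v\<close> of \<open>G\<close> has degree \<open>N - 2 d(v)\<close> in the transformation graph
  \<open>G\<^sup>-\<^sup>-\<^sup>-\<close>, and an edge \<open>uv\<close> has degree \<open>N - (d(u) + d(v))\<close>. Expanding the cubes and summing over
  vertices and edges, the power sums of \<open>d(u) + d(v)\<close> over the edges are expressed through the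
  given indices by double counting.
\<close>

lemma int_card_Diff:
  assumes "A \<subseteq> B" "finite B"
  shows "int (card (B - A)) = int (card B) - int (card A)"
  using assms by (simp add: card_Diff_subset card_mono of_nat_diff finite_subset)

lemma edgeE:
  assumes "finite_simple_graph H" "e \<in> edges H"
  obtains u v where "u \<noteq> v" "e = {u, v}" "u \<in> verts H" "v \<in> verts H"
proof -
  have "e \<subseteq> verts H" "card e = 2" using assms by (auto simp: finite_simple_graph_def)
  then show thesis using that by (auto simp: card_2_iff)
qed

lemma not_adjacent_self:
  assumes "finite_simple_graph H"
  shows "\<not> adjacent H v v"
  using assms unfolding finite_simple_graph_def adjacent_def by fastforce

lemma adjacent_verts:
  assumes "finite_simple_graph H" "adjacent H u v"
  shows "u \<in> verts H" "v \<in> verts H"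
  using assms unfolding finite_simple_graph_def adjacent_def by auto

text \<open>Sending a neighbour \<open>u\<close> to the edge \<open>{v, u}\<close> is a bijection
  onto the edges at \<open>v\<close>. Degrees are defined by counting edges, whereas the
  transformation graph is described by its adjacency relation; this bridges the two.\<close>

lemma degree_eq_card_neighbours:
  assumes "finite_simple_graph H"
  shows "degree H v = card {u. adjacent H v u}"
proof -
  have "bij_betw (\<lambda>u. {v, u}) {u. adjacent H v u} {e. incident H v e}"
    unfolding bij_betw_def
  proof
    show "inj_on (\<lambda>u. {v, u}) {u. adjacent H v u}"
      by (auto simp: inj_on_def doubleton_eq_iff)
    show "(\<lambda>u. {v, u}) ` {u. adjacent H v u} = {e. incident H v e}"
    proof (intro equalityI subsetI)
      fix e assume "e \<in> {e. incident H v e}"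
      then have e: "e \<in> edges H" "v \<in> e" by (auto simp: incident_def)
      obtain a b where "e = {a, b}" by (rule edgeE[OF assms e(1)]) (rule that)
      with e have "\<exists>u. e = {v, u}" by auto
      with e show "e \<in> (\<lambda>u. {v, u}) ` {u. adjacent H v u}" by (auto simp: adjacent_def)
    qed (auto simp: adjacent_def incident_def)
  qed
  then show ?thesis by (simp add: degree_def bij_betw_same_card)
qed

text \<open>Double counting of incident vertex-edge pairs: swapping the sums, \<open>f v\<close>
  occurs once for each edge at \<open>v\<close>.\<close>

lemma sum_edges_sum_endpoints:
  fixes f :: "'a \<Rightarrow> int"
  assumes "finite_simple_graph H"
  shows "(\<Sum>e\<in>edges H. \<Sum>w\<in>e. f w) = (\<Sum>v\<in>verts H. int (degree H v) * f v)"
proof -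
  have fin: "finite (verts H)" "finite (edges H)"
    using assms finite_edges by (auto simp: finite_simple_graph_def)
  have "(\<Sum>e\<in>edges H. \<Sum>w\<in>e. f w) = (\<Sum>e\<in>edges H. \<Sum>w\<in>{w \<in> verts H. w \<in> e}. f w)"
    using assms by (intro sum.cong) (auto simp: finite_simple_graph_def)
  also have "\<dots> = (\<Sum>w\<in>verts H. \<Sum>e\<in>{e \<in> edges H. w \<in> e}. f w)"
    using fin by (rule sum.swap_restrict[OF _ _, symmetric])
  finally show ?thesis by (simp add: degree_def incident_def)
qed

text \<open>Inclusion-exclusion for the edges at the two endpoints of \<open>e\<close>: two distinct
  vertices lie on at most one common edge, so \<open>e\<close> alone is counted twice. As
  \<open>e\<close> is not adjacent to itself, both counts of it are surplus, hence the 2.\<close>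

lemma card_edge_adjacent:
  assumes G: "finite_simple_graph G" and e: "e \<in> edges G"
  shows "card {f. edge_adjacent G e f} + 2 = (\<Sum>w\<in>e. degree G w)"
proof -
  obtain u v where uv: "u \<noteq> v" "e = {u, v}" by (rule edgeE[OF G e]) (rule that)
  let ?I = "\<lambda>w. {f. incident G w f}"
  have fin: "finite (?I w)" for w
    by (rule finite_subset[OF _ finite_edges[OF G]]) (auto simp: incident_def)
  have "?I u \<inter> ?I v = {e}"
  proof (intro equalityI subsetI)
    fix f assume f: "f \<in> ?I u \<inter> ?I v"
    then have fG: "f \<in> edges G" by (auto simp: incident_def)
    obtain a b where "f = {a, b}" by (rule edgeE[OF G fG]) (rule that)
    with f uv show "f \<in> {e}" by (auto simp: incident_def)
  qed (use e uv in \<open>auto simp: incident_def\<close>)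
  moreover have "?I u \<union> ?I v = insert e {f. edge_adjacent G e f}"
    using e uv by (auto simp: incident_def edge_adjacent_def)
  moreover have "e \<notin> {f. edge_adjacent G e f}" by (simp add: edge_adjacent_def)
  moreover have "finite {f. edge_adjacent G e f}"
    by (rule finite_subset[OF _ finite_edges[OF G]]) (auto simp: edge_adjacent_def)
  ultimately have "degree G u + degree G v = card {f. edge_adjacent G e f} + 2"
    using card_Un_Int[OF fin fin, of u v] by (simp add: degree_def)
  with uv show ?thesis by simp
qed

text \<open>Among all m + n elements, \<open>v\<close> misses itself, its d(v) neighbours and its
  d(v) incident edges. Working in \<open>int\<close> avoids truncated subtraction.\<close>

lemma degree_transformation_graph_vertex:
  assumes G: "finite_simple_graph G" and v: "v \<in> verts G"
  shows "int (degree (transformation_graph Minus Minus Minus G) (Inl v)) =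
    int (card (edges G)) + int (card (verts G)) - 1 - 2 * int (degree G v)"
proof -
  have fin: "finite (verts G)" "finite (edges G)"
    using G finite_edges by (auto simp: finite_simple_graph_def)
  let ?A = "insert v {u. adjacent G v u}" and ?I = "{e. incident G v e}"
  have A: "?A \<subseteq> verts G" using adjacent_verts[OF G] v by auto
  then have finA: "finite ?A" by (rule finite_subset) (rule fin)
  have I: "?I \<subseteq> edges G" by (auto simp: incident_def)
  have "{b. adjacent (transformation_graph Minus Minus Minus G) (Inl v) b} =
      (verts G - ?A) <+> (edges G - ?I)"
    using v by (auto simp: adjacent_transformation_graph)
  then have "degree (transformation_graph Minus Minus Minus G) (Inl v) =
      card (verts G - ?A) + card (edges G - ?I)"
    using fin
    by (simp add: degree_eq_card_neighbours finite_simple_graph_transformation_graph G card_Plus)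
  moreover have "int (card (verts G - ?A)) = int (card (verts G)) - int (card ?A)"
    by (rule int_card_Diff) (use A fin in auto)
  moreover have "card ?A = degree G v + 1"
    using finA not_adjacent_self[OF G] by (simp add: degree_eq_card_neighbours[OF G])
  moreover have "int (card (edges G - ?I)) = int (card (edges G)) - int (degree G v)"
    unfolding degree_def by (rule int_card_Diff) (use I fin in auto)
  ultimately show ?thesis by simp
qed

text \<open>An edge \<open>e\<close> misses its 2 endpoints, itself, and its adjacent edges, which
  number 2 less than the degree sum of its endpoints. The two 2s cancel, so only \<open>e\<close>
  itself accounts for the -1.\<close>

lemma degree_transformation_graph_edge:
  assumes G: "finite_simple_graph G" and e: "e \<in> edges G"
  shows "int (degree (transformation_graph Minus Minus Minus G) (Inr e)) =
    int (card (edges G)) + int (card (verts G)) - 1 - (\<Sum>w\<in>e. int (degree G w))"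
proof -
  have fin: "finite (verts G)" "finite (edges G)"
    using G finite_edges by (auto simp: finite_simple_graph_def)
  let ?A = "insert e {f. edge_adjacent G e f}"
  have A: "?A \<subseteq> edges G" using e by (auto simp: edge_adjacent_def)
  then have finA: "finite ?A" by (rule finite_subset) (rule fin)
  have ee: "e \<subseteq> verts G" "card e = 2" using G e by (auto simp: finite_simple_graph_def)
  have "{b. adjacent (transformation_graph Minus Minus Minus G) (Inr e) b} =
      (verts G - e) <+> (edges G - ?A)"
    using e by (auto simp: adjacent_transformation_graph incident_def)
  then have "degree (transformation_graph Minus Minus Minus G) (Inr e) =
      card (verts G - e) + card (edges G - ?A)"
    using fin
    by (simp add: degree_eq_card_neighbours finite_simple_graph_transformation_graph G card_Plus)
  moreover have "int (card (edges G - ?A)) = int (card (edges G)) - int (card ?A)"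
    by (rule int_card_Diff) (use A fin in auto)
  moreover have "card ?A = card {f. edge_adjacent G e f} + 1"
    using finA by (simp add: edge_adjacent_def)
  moreover have "int (card (verts G - e)) = int (card (verts G)) - 2"
    using int_card_Diff[OF ee(1) fin(1)] ee(2) by simp
  moreover have "int (card {f. edge_adjacent G e f}) + 2 = (\<Sum>w\<in>e. int (degree G w))"
    using card_edge_adjacent[OF G e] by (metis of_nat_add of_nat_numeral of_nat_sum)
  ultimately show ?thesis by simp
qed

theorem theorem3:
  fixes G :: "'a graph" and n m :: int
  assumes "finite_simple_graph G"
    and "connected_graph G"
    and "n = int (card (verts G))"
    and "m = int (card (edges G))"
  shows "int (F_index (transformation_graph Minus Minus Minus G)) =
      (3 * m + 3 * n - 11) * int (F_index G)
      - 3 * (m + n - 1) * (m + n - 5) * int (M1 G)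
      + 6 * (m + n - 1) * int (M2 G)
      - int (xi4 G)
      - 3 * int (ReZG3 G)
      + (m + n) * (m + n - 1) ^ 3
      - 12 * m * (m + n - 1) ^ 2"
proof -
  define N where "N = m + n - 1"
  define d where "d v = int (degree G v)" for v
  define s where "s e = (\<Sum>w\<in>e. d w)" for e
  define p where "p e = (\<Prod>w\<in>e. d w)" for e
  note G = assms(1)
  have fin: "finite (verts G)" "finite (edges G)"
    using G finite_edges by (auto simp: finite_simple_graph_def)
  have F: "int (F_index G) = (\<Sum>v\<in>verts G. d v ^ 3)"
    and M1: "int (M1 G) = (\<Sum>v\<in>verts G. d v ^ 2)"
    and M2: "int (M2 G) = (\<Sum>e\<in>edges G. p e)"
    and xi: "int (xi4 G) = (\<Sum>v\<in>verts G. d v ^ 4)"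
    and Re: "int (ReZG3 G) = (\<Sum>e\<in>edges G. p e * s e)"
    by (simp_all add: F_index_def M1_def M2_def xi4_def ReZG3_def d_def s_def p_def)
  have count: "(\<Sum>e\<in>edges G. \<Sum>w\<in>e. d w ^ k) = (\<Sum>v\<in>verts G. d v ^ Suc k)" for k
    using sum_edges_sum_endpoints[OF G, of "\<lambda>w. d w ^ k"] by (simp add: d_def)
  \<comment> \<open>The case \<open>k = 0\<close> of \<open>count\<close>: each endpoint contributes
    1, so each edge contributes its cardinality 2.\<close>
  have handshake: "(\<Sum>v\<in>verts G. d v) = 2 * m"
  proof -
    have "(\<Sum>v\<in>verts G. d v) = (\<Sum>e\<in>edges G. int (card e))"
      using count[of 0] by simp
    also have "\<dots> = (\<Sum>e\<in>edges G. 2)"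
      using G by (intro sum.cong) (auto simp: finite_simple_graph_def)
    finally show ?thesis using assms(4) by simp
  qed
  have s1: "(\<Sum>e\<in>edges G. s e) = int (M1 G)"
    using count[of 1] by (simp add: s_def M1 power2_eq_square)
  \<comment> \<open>With a, b the degrees of the endpoints: (a + b)^2 = a^2 + b^2 + 2ab and (a +
    b)^3 = a^3 + b^3 + 3ab(a + b). The mixed terms are the summands of \<open>M2\<close> and
    \<open>ReZG3\<close>.\<close>
  have "s e ^ 2 = (\<Sum>w\<in>e. d w ^ 2) + 2 * p e"
    and "s e ^ 3 = (\<Sum>w\<in>e. d w ^ 3) + 3 * (p e * s e)" if eG: "e \<in> edges G" for e
  proof -
    obtain u v where "u \<noteq> v" "e = {u, v}" by (rule edgeE[OF G eG]) (rule that)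
    then show "s e ^ 2 = (\<Sum>w\<in>e. d w ^ 2) + 2 * p e"
      and "s e ^ 3 = (\<Sum>w\<in>e. d w ^ 3) + 3 * (p e * s e)"
      by (simp_all add: s_def p_def power2_eq_square power3_eq_cube algebra_simps)
  qed
  \<comment> \<open>Double counting raises the exponent by one, so endpoint squares sum to
    \<open>F_index\<close> and endpoint cubes to \<open>xi4\<close>.\<close>
  then have s2: "(\<Sum>e\<in>edges G. s e ^ 2) = int (F_index G) + 2 * int (M2 G)"
    and s3: "(\<Sum>e\<in>edges G. s e ^ 3) = int (xi4 G) + 3 * int (ReZG3 G)"
    using count[of 2] count[of 3]
    by (simp_all add: sum.distrib F M2 xi Re flip: sum_distrib_left)
  have "int (F_index (transformation_graph Minus Minus Minus G)) =
      (\<Sum>a\<in>verts G <+> edges G. int (degree (transformation_graph Minus Minus Minus G) a) ^ 3)"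
    by (simp add: F_index_def) (simp add: transformation_graph_def)
  also have "\<dots> = (\<Sum>v\<in>verts G. (N - 2 * d v) ^ 3) + (\<Sum>e\<in>edges G. (N - s e) ^ 3)"
    using fin assms(3,4)
    by (simp add: sum.Plus degree_transformation_graph_vertex[OF G]
        degree_transformation_graph_edge[OF G] N_def d_def s_def)
  also have "(\<Sum>v\<in>verts G. (N - 2 * d v) ^ 3) =
      (\<Sum>v\<in>verts G. N ^ 3 - 6 * N ^ 2 * d v + 12 * N * d v ^ 2 - 8 * d v ^ 3)"
    by (intro sum.cong refl) algebra
  also have "\<dots> = n * N ^ 3 - 6 * N ^ 2 * (2 * m) + 12 * N * int (M1 G) - 8 * int (F_index G)"
    using assms(3)
    by (simp add: sum.distrib sum_subtractf F M1 handshake flip: sum_distrib_left)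
  also have "(\<Sum>e\<in>edges G. (N - s e) ^ 3) =
      (\<Sum>e\<in>edges G. N ^ 3 - 3 * N ^ 2 * s e + 3 * N * s e ^ 2 - s e ^ 3)"
    by (intro sum.cong refl) algebra
  also have "\<dots> = m * N ^ 3 - 3 * N ^ 2 * int (M1 G)
      + 3 * N * (int (F_index G) + 2 * int (M2 G)) - (int (xi4 G) + 3 * int (ReZG3 G))"
    using assms(4)
    by (simp add: sum.distrib sum_subtractf s1 s2 s3 flip: sum_distrib_left)
  \<comment> \<open>Collecting terms: \<open>F_index\<close> gets 3N - 8 = 3m + 3n - 11, and
    \<open>M1\<close> gets 12N - 3N^2 = -3N(N - 4), where N - 4 = m + n - 5.\<close>
  finally show ?thesis unfolding N_def by algebra
qed

end
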